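(* Let $\Omega$ be a completely regular Hausdorff Baire space, let $(f_\alpha)$ be a net in $C(\Omega)$ and let $f\in C(\Omega)$. If $(f_\alpha)$ uo-converges to $f$ in $C(\Omega)$, then there is a co-meagre set $D\subseteq\Omega$ such that $f_\alpha(t)\to f(t)$ for every $t\in D$. The converse is true for countable nets (in particular, for sequences): if the index set of $(f_\alpha)$ is countable and $f_\alpha(t)\to f(t)$ for every $t$ in some co-meagre set, then $(f_\alpha)$ uo-converges to $f$ in $C(\Omega)$.
   Context: $C(\Omega)$ is the vector lattice of all real-valued continuous functions on $\Omega$ with pointwise operations and order. A net $(x_\alpha)$ in a vector lattice $X$ converges in order to $x$ if there is a net $(u_\gamma)$ in $X$, possibly with a different index set, such that $u_\gamma\downarrow 0$ (decreasing with infimum $0$ in $X$) and for every $\gamma$ there exists $\alpha_0$ with $|x_\alpha-x|\leqslant u_\gamma$ for all $\alpha\geqslant\alpha_0$. The net uo-converges to $x$ if for every $u\geqslant 0$ in $X$ the net $(|x_\alpha-x|\wedge u)$ converges in order to $0$. A set is nowhere dense if its closure has empty interior, meagre if it is a countable union of nowhere dense sets, and co-meagre if its complement is meagre. A Baire space is a topological space in which every countable intersection of dense open sets is dense. *)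

theory Defs
  imports "HOL-Analysis.Analysis" "HOL-Library.Lattice_Algebras"
begin

section \<open>Baire category\<close>

definition nowhere_dense_in :: "'a topology \<Rightarrow> 'a set \<Rightarrow> bool" where
  "nowhere_dense_in X S \<longleftrightarrow> S \<subseteq> topspace X \<and> X interior_of (X closure_of S) = {}"

definition meagre_in :: "'a topology \<Rightarrow> 'a set \<Rightarrow> bool" where
  "meagre_in X S \<longleftrightarrow> (\<exists>\<F>. countable \<F> \<and> (\<forall>N\<in>\<F>. nowhere_dense_in X N) \<and> S = \<Union>\<F>)"

definition comeagre_in :: "'a topology \<Rightarrow> 'a set \<Rightarrow> bool" where
  "comeagre_in X D \<longleftrightarrow> D \<subseteq> topspace X \<and> meagre_in X (topspace X - D)"

definition baire_space :: "'a topology \<Rightarrow> bool" where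
  "baire_space X \<longleftrightarrow>
     (\<forall>\<G>. countable \<G> \<and> (\<forall>G\<in>\<G>. openin X G \<and> X closure_of G = topspace X)
        \<longrightarrow> X closure_of (\<Inter>\<G>) = topspace X)"


section \<open>Nets\<close>

text \<open>
  A net is a family restricted to an index set \<open>I\<close> that is directed by a preorder \<open>le\<close>,
  where \<open>le a b\<close> reads ``\<open>b\<close> is at least \<open>a\<close>''. Only the behaviour of \<open>le\<close> and of the
  family on \<open>I\<close> matters. Antisymmetry is not required.
\<close>

definition directed_index :: "'i set \<Rightarrow> ('i \<Rightarrow> 'i \<Rightarrow> bool) \<Rightarrow> bool" where
  "directed_index I le \<longleftrightarrow>
     I \<noteq> {} \<and> reflp_on I le \<and> transp_on I le \<and>
     (\<forall>a\<in>I. \<forall>b\<in>I. \<exists>c\<in>I. le a c \<and> le b c)"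

definition tails :: "'i set \<Rightarrow> ('i \<Rightarrow> 'i \<Rightarrow> bool) \<Rightarrow> 'i filter" where
  "tails I le = (INF a\<in>I. principal {b\<in>I. le a b})"

lemma eventually_tails:
  assumes "directed_index I le"
  shows "eventually P (tails I le) \<longleftrightarrow> (\<exists>a\<in>I. \<forall>b\<in>I. le a b \<longrightarrow> P b)"
proof -
  have "eventually P (tails I le) \<longleftrightarrow>
      (\<exists>a\<in>I. eventually P (principal {b\<in>I. le a b}))"
    unfolding tails_def
  proof (rule eventually_INF_base)
    show "I \<noteq> {}" using assms by (simp add: directed_index_def)
    fix a b assume ab: "a \<in> I" "b \<in> I"
    with assms obtain c where c: "c \<in> I" "le a c" "le b c"
      unfolding directed_index_def by blast
    have "transp_on I le" using assms by (simp add: directed_index_def)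
    then have "{d\<in>I. le c d} \<subseteq> {d\<in>I. le a d} \<inter> {d\<in>I. le b d}"
      using ab c by (auto dest: transp_onD)
    with c show "\<exists>x\<in>I. principal {d\<in>I. le x d} \<le>
        inf (principal {d\<in>I. le a d}) (principal {d\<in>I. le b d})"
      by auto
  qed
  then show ?thesis by (auto simp: eventually_principal)
qed


section \<open>Order convergence and unbounded order convergence in vector lattices\<close>

class vector_lattice = ordered_real_vector + lattice_ab_group_add_abs

definition is_infimum :: "'x::order set \<Rightarrow> 'x \<Rightarrow> bool" where
  "is_infimum A x \<longleftrightarrow> (\<forall>a\<in>A. x \<le> a) \<and> (\<forall>y. (\<forall>a\<in>A. y \<le> a) \<longrightarrow> y \<le> x)"

definition net_decreases_to ::
  "'g set \<Rightarrow> ('g \<Rightarrow> 'g \<Rightarrow> bool) \<Rightarrow> ('g \<Rightarrow> 'x::order) \<Rightarrow> 'x \<Rightarrow> bool" where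
  "net_decreases_to G leG u x \<longleftrightarrow>
     (\<forall>a\<in>G. \<forall>b\<in>G. leG a b \<longrightarrow> u b \<le> u a) \<and> is_infimum (u ` G) x"

text \<open>
  The dominating net may have an index set unrelated to that of the given net. Since HOL has no
  quantification over types, its index set is taken inside the vector lattice itself. This loses
  nothing, because a decreasing net can be indexed by its own range with the reversed order;
  see \<open>order_convergesI\<close>.
\<close>

definition order_converges ::
  "'i set \<Rightarrow> ('i \<Rightarrow> 'i \<Rightarrow> bool) \<Rightarrow> ('i \<Rightarrow> 'x::vector_lattice) \<Rightarrow> 'x \<Rightarrow> bool" where
  "order_converges I le x l \<longleftrightarrow>
     (\<exists>(G :: 'x set) leG u.
        directed_index G leG \<and> net_decreases_to G leG u 0 \<and>
        (\<forall>c\<in>G. \<exists>a0\<in>I. \<forall>a\<in>I. le a0 a \<longrightarrow> \<bar>x a - l\<bar> \<le> u c))"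

lemma order_convergesI:
  fixes x :: "'i \<Rightarrow> 'x::vector_lattice" and G :: "'g set"
  assumes G: "directed_index G leG" and u: "net_decreases_to G leG u 0"
    and dom: "\<forall>c\<in>G. \<exists>a0\<in>I. \<forall>a\<in>I. le a0 a \<longrightarrow> \<bar>x a - l\<bar> \<le> u c"
  shows "order_converges I le x l"
  unfolding order_converges_def
proof (intro exI conjI)
  show "directed_index (u ` G) (\<lambda>v w. w \<le> v)"
    unfolding directed_index_def
  proof (intro conjI ballI)
    show "u ` G \<noteq> {}" using G by (simp add: directed_index_def)
    show "reflp_on (u ` G) (\<lambda>v w. w \<le> v)" by (simp add: reflp_on_def)
    show "transp_on (u ` G) (\<lambda>v w. w \<le> v)" by (auto simp: transp_on_def)
    fix v w assume "v \<in> u ` G" "w \<in> u ` G"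
    then obtain a b where ab: "a \<in> G" "b \<in> G" "v = u a" "w = u b" by blast
    then obtain c where "c \<in> G" "leG a c" "leG b c"
      using G unfolding directed_index_def by blast
    then show "\<exists>z\<in>u ` G. z \<le> v \<and> z \<le> w"
      using ab u unfolding net_decreases_to_def by blast
  qed
  show "net_decreases_to (u ` G) (\<lambda>v w. w \<le> v) (\<lambda>v. v) 0"
    using u by (simp add: net_decreases_to_def)
  show "\<forall>c\<in>u ` G. \<exists>a0\<in>I. \<forall>a\<in>I. le a0 a \<longrightarrow> \<bar>x a - l\<bar> \<le> c"
    using dom by auto
qed

definition uo_converges ::
  "'i set \<Rightarrow> ('i \<Rightarrow> 'i \<Rightarrow> bool) \<Rightarrow> ('i \<Rightarrow> 'x::vector_lattice) \<Rightarrow> 'x \<Rightarrow> bool" where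
  "uo_converges I le x l \<longleftrightarrow>
     (\<forall>u. 0 \<le> u \<longrightarrow> order_converges I le (\<lambda>a. inf \<bar>x a - l\<bar> u) 0)"


section \<open>The vector lattice of continuous real-valued functions\<close>

typedef (overloaded) 'a cont_fun = "{f :: 'a::topological_space \<Rightarrow> real. continuous_on UNIV f}"
  morphisms app_fun Cont_fun
  by (rule exI[of _ "\<lambda>_. 0"]) simp

setup_lifting type_definition_cont_fun

instantiation cont_fun :: (topological_space) vector_lattice
begin

lift_definition zero_cont_fun :: "'a cont_fun" is "\<lambda>_. 0" by simp
lift_definition plus_cont_fun :: "'a cont_fun \<Rightarrow> 'a cont_fun \<Rightarrow> 'a cont_fun"
  is "\<lambda>f g t. f t + g t" by (rule continuous_on_add)
lift_definition minus_cont_fun :: "'a cont_fun \<Rightarrow> 'a cont_fun \<Rightarrow> 'a cont_fun"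
  is "\<lambda>f g t. f t - g t" by (rule continuous_on_diff)
lift_definition uminus_cont_fun :: "'a cont_fun \<Rightarrow> 'a cont_fun"
  is "\<lambda>f t. - f t" by (rule continuous_on_minus)
lift_definition scaleR_cont_fun :: "real \<Rightarrow> 'a cont_fun \<Rightarrow> 'a cont_fun"
  is "\<lambda>c f t. c * f t" by (intro continuous_intros)
lift_definition less_eq_cont_fun :: "'a cont_fun \<Rightarrow> 'a cont_fun \<Rightarrow> bool"
  is "\<lambda>f g. \<forall>t. f t \<le> g t" .
definition less_cont_fun :: "'a cont_fun \<Rightarrow> 'a cont_fun \<Rightarrow> bool"
  where "less_cont_fun f g \<longleftrightarrow> f \<le> g \<and> \<not> g \<le> f"
lift_definition inf_cont_fun :: "'a cont_fun \<Rightarrow> 'a cont_fun \<Rightarrow> 'a cont_fun"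
  is "\<lambda>f g t. min (f t) (g t)" by (rule continuous_on_min)
lift_definition sup_cont_fun :: "'a cont_fun \<Rightarrow> 'a cont_fun \<Rightarrow> 'a cont_fun"
  is "\<lambda>f g t. max (f t) (g t)" by (rule continuous_on_max)
lift_definition abs_cont_fun :: "'a cont_fun \<Rightarrow> 'a cont_fun"
  is "\<lambda>f t. \<bar>f t\<bar>" by (rule continuous_on_rabs)

instance
proof
  fix f g h :: "'a cont_fun" and c d :: real
  show "f + g + h = f + (g + h)" by transfer (simp add: add.assoc)
  show "f + g = g + f" by transfer (simp add: add.commute)
  show "0 + f = f" by transfer simp
  show "- f + f = 0" by transfer simp
  show "f - g = f + - g" by transfer simp
  show "c *\<^sub>R (f + g) = c *\<^sub>R f + c *\<^sub>R g" by transfer (simp add: distrib_left)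
  show "(c + d) *\<^sub>R f = c *\<^sub>R f + d *\<^sub>R f" by transfer (simp add: distrib_right)
  show "c *\<^sub>R d *\<^sub>R f = (c * d) *\<^sub>R f" by transfer (simp add: mult.assoc)
  show "1 *\<^sub>R f = f" by transfer simp
  show "f < g \<longleftrightarrow> f \<le> g \<and> \<not> g \<le> f" by (rule less_cont_fun_def)
  show "f \<le> f" by transfer simp
  show "f \<le> g \<Longrightarrow> g \<le> h \<Longrightarrow> f \<le> h" by transfer (blast intro: order_trans)
  show "f \<le> g \<Longrightarrow> g \<le> f \<Longrightarrow> f = g" by transfer (auto intro: antisym)
  show "f \<le> g \<Longrightarrow> h + f \<le> h + g" by transfer simp
  show "f \<le> g \<Longrightarrow> 0 \<le> c \<Longrightarrow> c *\<^sub>R f \<le> c *\<^sub>R g" by transfer (simp add: mult_left_mono)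
  show "c \<le> d \<Longrightarrow> 0 \<le> f \<Longrightarrow> c *\<^sub>R f \<le> d *\<^sub>R f" by transfer (simp add: mult_right_mono)
  show "inf f g \<le> f" by transfer simp
  show "inf f g \<le> g" by transfer simp
  show "f \<le> g \<Longrightarrow> f \<le> h \<Longrightarrow> f \<le> inf g h" by transfer simp
  show "f \<le> sup f g" by transfer simp
  show "g \<le> sup f g" by transfer simp
  show "g \<le> f \<Longrightarrow> h \<le> f \<Longrightarrow> sup g h \<le> f" by transfer simp
  show "\<bar>f\<bar> = sup f (- f)" by transfer (auto simp: fun_eq_iff)
qed

end

end

theory Submission
  imports Defs
begin

text \<open>
  Everything rests on the bump functions that complete regularity provides: they turn statements
  about infima in the lattice of continuous functions into statements about dense sets.

  Suppose that the net uo-converges. Truncate at the constant \<open>1\<close>, so that a net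
  \<open>u\<^sub>c \<down> 0\<close> eventually dominates \<open>\<bar>F\<^sub>a - f\<bar> \<and> 1\<close>. The infimum of a decreasing net of
  continuous functions need not be computed pointwise, but for each \<open>\<epsilon> > 0\<close> the open set
  \<open>\<Union>\<^sub>c {u\<^sub>c < \<epsilon>}\<close> is dense, since otherwise a small bump would fit below every \<open>u\<^sub>c\<close>
  (\<open>dense_Union_small_values\<close>). Intersecting over \<open>\<epsilon> = 1/(n+1)\<close> gives a co-meagre set of
  points where \<open>inf\<^sub>c u\<^sub>c(t) = 0\<close>, and there the net converges.

  Suppose conversely that the net converges on a co-meagre set \<open>D\<close> and that its index set is
  countable. For a given truncation \<open>u\<close>, the candidate for the dominating net is the set of all
  continuous functions that eventually dominate \<open>\<bar>F\<^sub>a - f\<bar> \<and> u\<close>; the point is that a lower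
  bound \<open>w\<close> of this set satisfies \<open>w \<le> 0\<close>. For \<open>\<delta> > 0\<close> the closed sets of points where a
  whole tail of \<open>\<bar>F\<^sub>a - f\<bar>\<close> is bounded by \<open>\<delta>\<close> cover \<open>D\<close>, and there are only countably
  many of them. So by the Baire property every nonempty open set contains a nonempty open set on
  which one tail is uniformly bounded by \<open>\<delta>\<close> (\<open>uniform_tail_bound_on_open_subset\<close>). Bending
  \<open>u\<close> to the value \<open>\<delta>\<close> at a point of that open set, by means of a bump, yields an eventual
  dominator. Hence no nonempty open set satisfies \<open>w > \<delta>\<close> throughout, whatever \<open>\<delta> > 0\<close>,
  and \<open>w \<le> 0\<close> because \<open>w\<close> is continuous.
\<close>

section \<open>Category\<close>

lemma closure_of_euclidean_UNIV_iff:
  fixes S :: "'a::topological_space set"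
  shows "euclidean closure_of S = topspace euclidean \<longleftrightarrow> (\<forall>V. open V \<and> V \<noteq> {} \<longrightarrow> S \<inter> V \<noteq> {})"
  using dense_intersects_open[of "euclidean :: 'a topology" S] by simp

lemma nowhere_dense_in_Compl_open_dense:
  fixes U :: "'a::topological_space set"
  assumes "open U" "euclidean closure_of U = topspace euclidean"
  shows "nowhere_dense_in euclidean (- U)"
proof -
  have "closure U = UNIV"
    using assms(2) by simp
  then have "interior (- U) = {}"
    by (simp add: interior_complement)
  then show ?thesis
    using assms(1) by (simp add: nowhere_dense_in_def closure_closed closed_Compl)
qed

lemma comeagre_in_INT_open_dense:
  fixes W :: "'b \<Rightarrow> 'a::topological_space set"
  assumes "countable N"
    and "\<And>n. n \<in> N \<Longrightarrow> open (W n)"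
    and "\<And>n. n \<in> N \<Longrightarrow> euclidean closure_of (W n) = topspace euclidean"
  shows "comeagre_in euclidean (\<Inter>n\<in>N. W n)"
  unfolding comeagre_in_def meagre_in_def
proof (intro conjI exI)
  show "countable ((\<lambda>n. - W n) ` N)"
    using assms(1) by simp
  show "\<forall>S\<in>(\<lambda>n. - W n) ` N. nowhere_dense_in euclidean S"
    using nowhere_dense_in_Compl_open_dense assms(2,3) by blast
qed auto

lemma comeagre_in_contains_INT_open_dense:
  fixes D :: "'a::topological_space set"
  assumes "comeagre_in euclidean D"
  obtains \<G> where "countable \<G>"
    and "\<And>G. G \<in> \<G> \<Longrightarrow> open G \<and> euclidean closure_of G = topspace euclidean"
    and "\<Inter>\<G> \<subseteq> D"
proof -
  obtain \<F> where \<F>: "countable \<F>" "\<And>N. N \<in> \<F> \<Longrightarrow> nowhere_dense_in euclidean N" "- D = \<Union>\<F>"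
    using assms unfolding comeagre_in_def meagre_in_def by (auto simp: Compl_eq_Diff_UNIV)
  show thesis
  proof (rule that[of "(\<lambda>N. - closure N) ` \<F>"])
    show "countable ((\<lambda>N. - closure N) ` \<F>)"
      using \<F>(1) by simp
    show "open G \<and> euclidean closure_of G = topspace euclidean"
      if "G \<in> (\<lambda>N. - closure N) ` \<F>" for G
      using that \<F>(2) by (auto simp: nowhere_dense_in_def closure_complement)
    show "\<Inter> ((\<lambda>N. - closure N) ` \<F>) \<subseteq> D"
      using \<F>(3) closure_subset by blast
  qed
qed

text \<open>
  The Baire category theorem in its covering form, relative to a co-meagre set. The proof
  intersects the dense open sets that witness co-meagreness with the sets
  \<open>interior (C a) \<union> - C a\<close>, which are dense because a closed set has a nowhere dense
  frontier; a point of this intersection that lies in \<open>C a\<close> lies in its interior.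
\<close>
lemma baire_closed_cover_interior:
  fixes C :: "'b \<Rightarrow> 'a::topological_space set"
  assumes baire: "baire_space (euclidean :: 'a topology)"
    and D: "comeagre_in euclidean D"
    and I: "countable I"
    and closed: "\<And>a. a \<in> I \<Longrightarrow> closed (C a)"
    and cover: "D \<subseteq> (\<Union>a\<in>I. C a)"
    and V: "open V" "V \<noteq> {}"
  obtains a where "a \<in> I" "V \<inter> interior (C a) \<noteq> {}"
proof -
  obtain \<G> where \<G>: "countable \<G>"
    "\<And>G. G \<in> \<G> \<Longrightarrow> open G \<and> euclidean closure_of G = topspace euclidean" "\<Inter>\<G> \<subseteq> D"
    using comeagre_in_contains_INT_open_dense[OF D] by blast
  define \<H> where "\<H> = \<G> \<union> (\<lambda>a. interior (C a) \<union> - C a) ` I"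
  have "countable \<H>"
    using \<G>(1) I by (simp add: \<H>_def)
  moreover have "openin euclidean H \<and> euclidean closure_of H = topspace euclidean"
    if "H \<in> \<H>" for H
  proof -
    have "open (interior (C a) \<union> - C a)" if "a \<in> I" for a
      using closed[OF that] by (simp add: open_Un open_Compl)
    moreover have "closure (interior (C a) \<union> - C a) = UNIV" for a
      using closure_subset[of "interior (C a)"] by (auto simp: closure_Un closure_complement)
    ultimately show ?thesis
      using that \<G>(2) unfolding \<H>_def by auto
  qed
  ultimately have "euclidean closure_of \<Inter>\<H> = topspace euclidean"
    using baire unfolding baire_space_def by blast
  then obtain t where t: "t \<in> \<Inter>\<H>" "t \<in> V"
    using V unfolding closure_of_euclidean_UNIV_iff by blast
  then have "t \<in> D"
    using \<G>(3) by (auto simp: \<H>_def)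
  then obtain a where a: "a \<in> I" "t \<in> C a"
    using cover by blast
  have "t \<in> interior (C a) \<union> - C a"
    using t(1) a(1) unfolding \<H>_def by blast
  with a t(2) have "V \<inter> interior (C a) \<noteq> {}"
    by blast
  with a(1) show thesis
    by (rule that)
qed

section \<open>Bump functions\<close>

lemma continuous_on_app_fun [continuous_intros]: "continuous_on A (app_fun f)"
  using app_fun[of f] continuous_on_subset by blast

lemma app_fun_Cont_fun: "continuous_on UNIV g \<Longrightarrow> app_fun (Cont_fun g) = g"
  by (simp add: Cont_fun_inverse)

lemma completely_regular_bump:
  fixes V :: "'a::topological_space set"
  assumes "completely_regular_space (euclidean :: 'a topology)" "open V" "t \<in> V"
  obtains h :: "'a \<Rightarrow> real" where "continuous_on UNIV h" "\<And>s. 0 \<le> h s" "\<And>s. h s \<le> 1"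
    "h t = 1" "\<And>s. s \<notin> V \<Longrightarrow> h s = 0"
proof -
  have "closedin euclidean (- V)" "t \<in> topspace euclidean - (- V)"
    using assms(2,3) by auto
  with assms(1) obtain k :: "'a \<Rightarrow> real" where
    k: "continuous_map euclidean (top_of_set {0..1}) k" "k t = 0" "k ` (- V) \<subseteq> {1}"
    unfolding completely_regular_space_def by blast
  then have "continuous_on UNIV k" "\<And>s. 0 \<le> k s \<and> k s \<le> 1"
    by (auto simp: continuous_map_in_subtopology)
  with k(2,3) show thesis
    by (intro that[of "\<lambda>s. 1 - k s"]) (auto intro!: continuous_intros)
qed

section \<open>From uo-convergence to pointwise convergence\<close>

text \<open>
  Where the union misses an open set, all members of \<open>A\<close> are at least \<open>e\<close>, so a bump of height
  \<open>e\<close> supported there is a lower bound of \<open>A\<close> that is not below \<open>0\<close>.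
\<close>
lemma dense_Union_small_values:
  fixes A :: "'a::topological_space cont_fun set"
  assumes "completely_regular_space (euclidean :: 'a topology)"
    and inf: "is_infimum A 0" and e: "e > 0"
  shows "euclidean closure_of (\<Union>v\<in>A. {t. app_fun v t < e}) = topspace euclidean"
  unfolding closure_of_euclidean_UNIV_iff
proof (intro allI impI notI)
  fix V :: "'a set"
  assume V: "open V \<and> V \<noteq> {}" and disj: "(\<Union>v\<in>A. {t. app_fun v t < e}) \<inter> V = {}"
  then obtain t where t: "t \<in> V"
    by blast
  obtain h :: "'a \<Rightarrow> real" where h: "continuous_on UNIV h" "\<And>s. 0 \<le> h s" "\<And>s. h s \<le> 1"
    "h t = 1" "\<And>s. s \<notin> V \<Longrightarrow> h s = 0"
    by (rule completely_regular_bump[OF assms(1) conjunct1[OF V] t]) blast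
  have app: "app_fun (Cont_fun (\<lambda>s. e * h s)) = (\<lambda>s. e * h s)"
    by (intro app_fun_Cont_fun continuous_intros h(1))
  have "Cont_fun (\<lambda>s. e * h s) \<le> v" if "v \<in> A" for v
    unfolding less_eq_cont_fun.rep_eq app
  proof
    fix s
    show "e * h s \<le> app_fun v s"
    proof (cases "s \<in> V")
      case True
      have "e * h s \<le> e"
        using h(3)[of s] e by simp
      also have "e \<le> app_fun v s"
        using True disj that by force
      finally show ?thesis .
    next
      case False
      have "0 \<le> v"
        using inf that by (simp add: is_infimum_def)
      then show ?thesis
        using False h(5) by (simp add: less_eq_cont_fun.rep_eq zero_cont_fun.rep_eq)
    qed
  qed
  then have "Cont_fun (\<lambda>s. e * h s) \<le> 0"
    using inf by (simp add: is_infimum_def)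
  then have "e * h t \<le> 0"
    by (simp add: less_eq_cont_fun.rep_eq zero_cont_fun.rep_eq app)
  with h(4) e show False
    by simp
qed

lemma uo_converges_imp_comeagre_tendsto:
  fixes F :: "'i \<Rightarrow> 'a::topological_space cont_fun"
  assumes creg: "completely_regular_space (euclidean :: 'a topology)"
    and dir: "directed_index I le"
    and uo: "uo_converges I le F f"
  obtains D where "comeagre_in euclidean D"
    "\<And>t. t \<in> D \<Longrightarrow> ((\<lambda>a. app_fun (F a) t) \<longlongrightarrow> app_fun f t) (tails I le)"
proof -
  define one :: "'a cont_fun" where "one = Cont_fun (\<lambda>_. 1)"
  have one: "app_fun one t = 1" for t
    by (simp add: one_def app_fun_Cont_fun)
  have "0 \<le> one"
    by (simp add: less_eq_cont_fun.rep_eq zero_cont_fun.rep_eq one)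
  then have "order_converges I le (\<lambda>a. inf \<bar>F a - f\<bar> one) 0"
    using uo by (simp add: uo_converges_def)
  then obtain G :: "'a cont_fun set" and leG u where
    inf: "is_infimum (u ` G) 0" and
    dom: "\<And>c. c \<in> G \<Longrightarrow> \<exists>a0\<in>I. \<forall>a\<in>I. le a0 a \<longrightarrow> \<bar>inf \<bar>F a - f\<bar> one - 0\<bar> \<le> u c"
    unfolding order_converges_def net_decreases_to_def by blast
  define W where "W n = (\<Union>v\<in>u ` G. {t. app_fun v t < inverse (real (Suc n))})" for n
  have "open (W n)" for n
    unfolding W_def by (intro open_UN ballI open_Collect_less continuous_intros)
  moreover have "euclidean closure_of (W n) = topspace euclidean" for n
    unfolding W_def by (rule dense_Union_small_values[OF creg inf]) simp
  ultimately have "comeagre_in euclidean (\<Inter>n. W n)"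
    by (intro comeagre_in_INT_open_dense) auto
  moreover have "((\<lambda>a. app_fun (F a) t) \<longlongrightarrow> app_fun f t) (tails I le)" if "t \<in> (\<Inter>n. W n)" for t
  proof (rule tendstoI)
    fix e :: real
    assume "0 < e"
    then obtain n where n: "inverse (real (Suc n)) < e"
      using reals_Archimedean by blast
    \<comment> \<open>The truncation is at \<open>1\<close>, so a bound below \<open>1\<close> on the truncated difference is a
       bound on the difference itself.\<close>
    have n1: "inverse (real (Suc n)) \<le> 1"
      by (simp add: divide_simps)
    from that obtain c where c: "c \<in> G" "app_fun (u c) t < inverse (real (Suc n))"
      unfolding W_def by blast
    from dom[OF c(1)] obtain a0 where a0: "a0 \<in> I"
      "\<And>a. a \<in> I \<Longrightarrow> le a0 a \<Longrightarrow> \<bar>inf \<bar>F a - f\<bar> one - 0\<bar> \<le> u c"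
      by blast
    have "dist (app_fun (F a) t) (app_fun f t) < e" if "a \<in> I" "le a0 a" for a
    proof -
      have "\<bar>min \<bar>app_fun (F a) t - app_fun f t\<bar> 1\<bar> \<le> app_fun (u c) t"
        using a0(2)[OF that]
        by (simp add: less_eq_cont_fun.rep_eq abs_cont_fun.rep_eq inf_cont_fun.rep_eq
            minus_cont_fun.rep_eq one)
      with c(2) n n1 show ?thesis
        by (auto simp: dist_real_def min_def split: if_splits)
    qed
    then show "\<forall>\<^sub>F a in tails I le. dist (app_fun (F a) t) (app_fun f t) < e"
      using a0(1) by (auto simp: eventually_tails[OF dir])
  qed
  ultimately show thesis
    by (rule that)
qed

section \<open>From pointwise convergence to uo-convergence\<close>

text \<open>
  Countability of the index set is what makes the Baire property applicable: the cover consists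
  of one closed set for each possible starting index of a tail.
\<close>
lemma uniform_tail_bound_on_open_subset:
  fixes F :: "'i \<Rightarrow> 'a::topological_space cont_fun"
  assumes baire: "baire_space (euclidean :: 'a topology)"
    and dir: "directed_index I le" and I: "countable I"
    and D: "comeagre_in euclidean D"
    and conv: "\<And>t. t \<in> D \<Longrightarrow> ((\<lambda>a. app_fun (F a) t) \<longlongrightarrow> app_fun f t) (tails I le)"
    and V: "open V" "V \<noteq> {}" and e: "e > 0"
  obtains U a where "open U" "U \<noteq> {}" "U \<subseteq> V" "a \<in> I"
    "\<And>b t. b \<in> I \<Longrightarrow> le a b \<Longrightarrow> t \<in> U \<Longrightarrow> \<bar>app_fun (F b) t - app_fun f t\<bar> \<le> e"
proof -
  define C where "C a = (\<Inter>b\<in>{b\<in>I. le a b}. {t. \<bar>app_fun (F b) t - app_fun f t\<bar> \<le> e})" for a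
  have closed: "closed (C a)" for a
    unfolding C_def by (intro closed_INT ballI closed_Collect_le continuous_intros)
  have "D \<subseteq> (\<Union>a\<in>I. C a)"
  proof
    fix t
    assume "t \<in> D"
    then have "\<forall>\<^sub>F b in tails I le. dist (app_fun (F b) t) (app_fun f t) < e"
      using conv e tendstoD by blast
    then show "t \<in> (\<Union>a\<in>I. C a)"
      unfolding eventually_tails[OF dir] C_def dist_real_def by force
  qed
  then obtain a where a: "a \<in> I" "V \<inter> interior (C a) \<noteq> {}"
    using baire_closed_cover_interior[where C = C, OF baire D I closed _ V] by metis
  show thesis
  proof (rule that[of "V \<inter> interior (C a)" a])
    show "\<bar>app_fun (F b) t - app_fun f t\<bar> \<le> e"
      if "b \<in> I" "le a b" "t \<in> V \<inter> interior (C a)" for b t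
    proof -
      have "t \<in> C a"
        using that(3) interior_subset by blast
      with that(1,2) show ?thesis
        by (simp add: C_def)
    qed
    show "open (V \<inter> interior (C a))"
      using V(1) by (simp add: open_Int)
  qed (use a in simp_all)
qed

text \<open>
  The set of all eventual upper bounds of the family is itself a dominating net: it is directed
  downwards because the meet of two eventual upper bounds is another one. So only its infimum
  needs attention.
\<close>
lemma order_converges_0_via_eventual_bounds:
  fixes x :: "'i \<Rightarrow> 'x::vector_lattice"
  assumes dir: "directed_index I le"
    and nonneg: "\<And>a. a \<in> I \<Longrightarrow> 0 \<le> x a"
    and ex: "a1 \<in> I" "\<And>a. a \<in> I \<Longrightarrow> le a1 a \<Longrightarrow> x a \<le> u"
    and lower: "\<And>w. (\<And>v a0. a0 \<in> I \<Longrightarrow> (\<And>a. a \<in> I \<Longrightarrow> le a0 a \<Longrightarrow> x a \<le> v) \<Longrightarrow> w \<le> v) \<Longrightarrow> w \<le> 0"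
  shows "order_converges I le x 0"
proof -
  define G where "G = {v. \<exists>a0\<in>I. \<forall>a\<in>I. le a0 a \<longrightarrow> x a \<le> v}"
  have reflp: "reflp_on I le" and transp: "transp_on I le"
    using dir by (auto simp: directed_index_def)
  have refl: "le a a" if "a \<in> I" for a
    using reflp that by (rule reflp_onD)
  have trans: "le a c" if "le a b" "le b c" "a \<in> I" "b \<in> I" "c \<in> I" for a b c
    using transp_onD[OF transp that(3-5)] that(1,2) by blast
  show ?thesis
  proof (rule order_convergesI[of G "\<lambda>v w. w \<le> v" "\<lambda>v. v"])
    show "directed_index G (\<lambda>v w. w \<le> v)"
      unfolding directed_index_def
    proof (intro conjI ballI)
      show "G \<noteq> {}"
        using ex unfolding G_def by blast
      show "reflp_on G (\<lambda>v w. w \<le> v)" "transp_on G (\<lambda>v w. w \<le> v)"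
        by (auto simp: reflp_on_def transp_on_def)
      fix v w
      assume "v \<in> G" "w \<in> G"
      then obtain a b where ab: "a \<in> I" "b \<in> I" "\<And>c. c \<in> I \<Longrightarrow> le a c \<Longrightarrow> x c \<le> v"
        "\<And>c. c \<in> I \<Longrightarrow> le b c \<Longrightarrow> x c \<le> w"
        unfolding G_def by blast
      moreover obtain c where "c \<in> I" "le a c" "le b c"
        using dir ab unfolding directed_index_def by blast
      ultimately have "x d \<le> inf v w" if "d \<in> I" "le c d" for d
        using trans that by (meson le_inf_iff)
      then have "inf v w \<in> G"
        using \<open>c \<in> I\<close> unfolding G_def by blast
      then show "\<exists>z\<in>G. z \<le> v \<and> z \<le> w"
        by (intro bexI[of _ "inf v w"]) auto
    qed
    have "0 \<le> v" if "v \<in> G" for v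
    proof -
      obtain a where "a \<in> I" "x a \<le> v"
        using \<open>v \<in> G\<close> refl unfolding G_def by blast
      with nonneg[of a] show ?thesis
        by simp
    qed
    moreover have "w \<le> 0" if "\<forall>v\<in>G. w \<le> v" for w
      using that unfolding G_def by (intro lower) auto
    ultimately show "net_decreases_to G (\<lambda>v w. w \<le> v) (\<lambda>v. v) 0"
      by (auto simp: net_decreases_to_def is_infimum_def)
    show "\<forall>v\<in>G. \<exists>a0\<in>I. \<forall>a\<in>I. le a0 a \<longrightarrow> \<bar>x a - 0\<bar> \<le> v"
      unfolding G_def using nonneg by simp
  qed
qed

lemma comeagre_tendsto_imp_uo_converges:
  fixes F :: "'i \<Rightarrow> 'a::topological_space cont_fun"
  assumes creg: "completely_regular_space (euclidean :: 'a topology)"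
    and baire: "baire_space (euclidean :: 'a topology)"
    and dir: "directed_index I le" and I: "countable I"
    and D: "comeagre_in euclidean D"
    and conv: "\<And>t. t \<in> D \<Longrightarrow> ((\<lambda>a. app_fun (F a) t) \<longlongrightarrow> app_fun f t) (tails I le)"
  shows "uo_converges I le F f"
  unfolding uo_converges_def
proof (intro allI impI)
  fix u :: "'a cont_fun"
  assume u: "0 \<le> u"
  have app_x: "app_fun (inf \<bar>F a - f\<bar> u) t = min \<bar>app_fun (F a) t - app_fun f t\<bar> (app_fun u t)"
    for a t
    by (simp add: abs_cont_fun.rep_eq inf_cont_fun.rep_eq minus_cont_fun.rep_eq)
  obtain a1 where a1: "a1 \<in> I"
    using dir by (auto simp: directed_index_def)
  show "order_converges I le (\<lambda>a. inf \<bar>F a - f\<bar> u) 0"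
  proof (rule order_converges_0_via_eventual_bounds[where u = u, OF dir _ a1])
    fix w
    assume lower: "\<And>v a0. a0 \<in> I \<Longrightarrow>
      (\<And>a. a \<in> I \<Longrightarrow> le a0 a \<Longrightarrow> inf \<bar>F a - f\<bar> u \<le> v) \<Longrightarrow> w \<le> v"
    show "w \<le> 0"
    proof (rule ccontr)
      assume "\<not> w \<le> 0"
      then obtain t0 where t0: "0 < app_fun w t0"
        by (auto simp: less_eq_cont_fun.rep_eq zero_cont_fun.rep_eq not_le)
      define d where "d = app_fun w t0 / 2"
      have d: "0 < d"
        using t0 by (simp add: d_def)
      define V where "V = {t. d < app_fun w t}"
      have V: "open V" "V \<noteq> {}"
        unfolding V_def using t0
        by (auto simp: d_def intro!: open_Collect_less continuous_intros exI[of _ t0])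
      obtain U a where U: "open U" "U \<noteq> {}" "U \<subseteq> V" and a: "a \<in> I"
        "\<And>b t. b \<in> I \<Longrightarrow> le a b \<Longrightarrow> t \<in> U \<Longrightarrow> \<bar>app_fun (F b) t - app_fun f t\<bar> \<le> d"
        by (rule uniform_tail_bound_on_open_subset[where F = F and f = f, OF baire dir I D conv V d])
          blast+
      from U obtain t where t: "t \<in> U"
        by blast
      obtain h :: "'a \<Rightarrow> real" where h: "continuous_on UNIV h" "\<And>s. 0 \<le> h s" "\<And>s. h s \<le> 1"
        "h t = 1" "\<And>s. s \<notin> U \<Longrightarrow> h s = 0"
        using completely_regular_bump[OF creg U(1) t] by blast
      \<comment> \<open>This convex combination equals \<open>u\<close> off \<open>U\<close> and \<open>d\<close> at \<open>t\<close>; on \<open>U\<close> both \<open>u\<close> and \<open>d\<close>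
         bound the tail, hence so does the combination.\<close>
      define v where "v = Cont_fun (\<lambda>s. (1 - h s) * app_fun u s + h s * d)"
      have app_v: "app_fun v s = (1 - h s) * app_fun u s + h s * d" for s
        unfolding v_def by (subst app_fun_Cont_fun) (intro continuous_intros h(1), simp)
      have "inf \<bar>F b - f\<bar> u \<le> v" if b: "b \<in> I" "le a b" for b
        unfolding less_eq_cont_fun.rep_eq app_x app_v
      proof
        fix s
        let ?m = "min \<bar>app_fun (F b) s - app_fun f s\<bar> (app_fun u s)"
        show "?m \<le> (1 - h s) * app_fun u s + h s * d"
        proof (cases "s \<in> U")
          case True
          then have "?m \<le> d"
            using a(2)[OF b] by (simp add: min.coboundedI1)
          then have "(1 - h s) * ?m + h s * ?m \<le> (1 - h s) * app_fun u s + h s * d"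
            using h(2,3)[of s] by (intro add_mono mult_left_mono) auto
          then show ?thesis
            by (simp add: algebra_simps)
        next
          case False
          then show ?thesis
            using h(5) by simp
        qed
      qed
      then have "w \<le> v"
        using lower a(1) by blast
      then have "app_fun w t \<le> d"
        using app_v[of t] h(4) by (metis less_eq_cont_fun.rep_eq mult_1 add_0 diff_self mult_zero_left)
      with t U(3) show False
        by (auto simp: V_def)
    qed
  qed (use u in auto)
qed

theorem theorem3p7:
  fixes I :: "'i set" and le :: "'i \<Rightarrow> 'i \<Rightarrow> bool"
    and F :: "'i \<Rightarrow> 'a::t2_space cont_fun" and f :: "'a cont_fun"
  assumes "completely_regular_space (euclidean :: 'a topology)"
    and "baire_space (euclidean :: 'a topology)"
    and "directed_index I le"
  shows "(uo_converges I le F f \<longrightarrow>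
            (\<exists>D. comeagre_in euclidean D \<and>
               (\<forall>t\<in>D. ((\<lambda>a. app_fun (F a) t) \<longlongrightarrow> app_fun f t) (tails I le)))) \<and>
         (countable I \<longrightarrow>
            (\<exists>D. comeagre_in euclidean D \<and>
               (\<forall>t\<in>D. ((\<lambda>a. app_fun (F a) t) \<longlongrightarrow> app_fun f t) (tails I le))) \<longrightarrow>
            uo_converges I le F f)"
proof (intro conjI impI)
  assume "uo_converges I le F f"
  with assms(1,3) obtain D where "comeagre_in euclidean D"
    "\<And>t. t \<in> D \<Longrightarrow> ((\<lambda>a. app_fun (F a) t) \<longlongrightarrow> app_fun f t) (tails I le)"
    by (rule uo_converges_imp_comeagre_tendsto) blast
  then show "\<exists>D. comeagre_in euclidean D \<and>
      (\<forall>t\<in>D. ((\<lambda>a. app_fun (F a) t) \<longlongrightarrow> app_fun f t) (tails I le))"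
    by (intro exI[of _ D] conjI ballI)
next
  assume I: "countable I" and "\<exists>D. comeagre_in euclidean D \<and>
      (\<forall>t\<in>D. ((\<lambda>a. app_fun (F a) t) \<longlongrightarrow> app_fun f t) (tails I le))"
  then obtain D where D: "comeagre_in euclidean D"
    "\<forall>t\<in>D. ((\<lambda>a. app_fun (F a) t) \<longlongrightarrow> app_fun f t) (tails I le)"
    by blast
  show "uo_converges I le F f"
    using assms I D(1) by (rule comeagre_tendsto_imp_uo_converges) (rule bspec[OF D(2)])
qed

end
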